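(* Let $T_P$ be the affine map with $T_P(A)=D$, $T_P(B)=E$, $T_P(C)=F$, where $DEF$ is the cevian triangle of $P$ with respect to $ABC$, and let $Q'=K(P)$. Then $T_P(K(P)) = T_P(Q') = P$.
   Context: The plane is the real Euclidean plane extended by the line at infinity $l_\infty$; points not on $l_\infty$ are ordinary, points on it are infinite. Affine maps are extended to act on $l_\infty$. For points $X,Y$, $XY$ denotes the line through them, and $\ell\cdot m$ denotes the intersection of lines $\ell,m$. $ABC$ is a nondegenerate triangle with ordinary vertices, its sides being full lines; $G$ is its centroid. The complement map $K$ is the affine map fixing $G$ and sending each ordinary $Y$ to the point $K(Y)$ with $\overrightarrow{GK(Y)}=-\tfrac12\overrightarrow{GY}$; it fixes every infinite point. The anticomplementary triangle is $K^{-1}(ABC)$. $P$ is a point (ordinary or infinite) not lying on the extended sides of $ABC$ or of its anticomplementary triangle. The cevian triangle $DEF$ of $P$ is given by $D=AP\cdot BC$, $E=BP\cdot AC$, $F=CP\cdot AB$ (all ordinary points). *)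

theory Defs
  imports "HOL-Analysis.Analysis"
begin

text \<open>An infinite point is a parallel class of lines of the Euclidean plane, represented by the
  common direction space of these lines.\<close>

typedef direction = "{L :: (real^2) set. subspace L \<and> dim L = 1}"
proof
  show "span {axis 1 1 :: real^2} \<in> {L. subspace L \<and> dim L = 1}"
    by (simp add: dim_singleton axis_eq_0_iff)
qed

datatype point = Ordinary "real^2" | Infinite direction

definition line_at_infinity :: "point set" where
  "line_at_infinity = range Infinite"

definition affine_line :: "real^2 \<Rightarrow> direction \<Rightarrow> point set" where
  "affine_line a d = insert (Infinite d) (Ordinary ` {a + v |v. v \<in> Rep_direction d})"

definition lines :: "point set set" where
  "lines = insert line_at_infinity {affine_line a d |a d. True}"

text \<open>Meaningful only for distinct points.\<close>

definition join :: "point \<Rightarrow> point \<Rightarrow> point set" where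
  "join X Y = (THE l. l \<in> lines \<and> X \<in> l \<and> Y \<in> l)"

text \<open>Meaningful only for distinct lines.\<close>

definition meet :: "point set \<Rightarrow> point set \<Rightarrow> point" where
  "meet l m = (THE X. X \<in> l \<and> X \<in> m)"

definition affine_map :: "(real^2 \<Rightarrow> real^2) \<Rightarrow> bool" where
  "affine_map f \<longleftrightarrow> (\<exists>g b. linear g \<and> (\<forall>x. f x = g x + b))"

text \<open>The extension of an affine map acts on directions by its linear part
  \<open>\<lambda>v. f v - f 0\<close>. The value at an infinite point is meaningful only if the linear part does not
  annihilate that direction; for bijective affine maps this is always the case.\<close>

fun extend :: "(real^2 \<Rightarrow> real^2) \<Rightarrow> point \<Rightarrow> point" where
  "extend f (Ordinary x) = Ordinary (f x)"
| "extend f (Infinite d) = Infinite (Abs_direction ((\<lambda>v. f v - f 0) ` Rep_direction d))"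

definition centroid :: "real^2 \<Rightarrow> real^2 \<Rightarrow> real^2 \<Rightarrow> real^2" where
  "centroid A B C = (1/3) *\<^sub>R (A + B + C)"

definition complement :: "real^2 \<Rightarrow> real^2 \<Rightarrow> real^2 \<Rightarrow> real^2 \<Rightarrow> real^2" where
  "complement A B C Y = centroid A B C + (- 1/2) *\<^sub>R (Y - centroid A B C)"

definition sides :: "real^2 \<Rightarrow> real^2 \<Rightarrow> real^2 \<Rightarrow> point set set" where
  "sides A B C = {join (Ordinary B) (Ordinary C),
                  join (Ordinary A) (Ordinary C),
                  join (Ordinary A) (Ordinary B)}"

definition anticomplementary_sides :: "real^2 \<Rightarrow> real^2 \<Rightarrow> real^2 \<Rightarrow> point set set" where
  "anticomplementary_sides A B C =
    (let K' = inv (complement A B C) in sides (K' A) (K' B) (K' C))"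

text \<open>The vertex on \<open>BC\<close> of the cevian triangle of \<open>P\<close>. The other two vertices are obtained by
  permuting the arguments.\<close>

definition cevian_trace :: "real^2 \<Rightarrow> real^2 \<Rightarrow> real^2 \<Rightarrow> point \<Rightarrow> point" where
  "cevian_trace A B C P = meet (join (Ordinary A) P) (join (Ordinary B) (Ordinary C))"

definition cevian_map :: "real^2 \<Rightarrow> real^2 \<Rightarrow> real^2 \<Rightarrow> point \<Rightarrow> real^2 \<Rightarrow> real^2" where
  "cevian_map A B C P = (THE T. affine_map T
     \<and> Ordinary (T A) = cevian_trace A B C P
     \<and> Ordinary (T B) = cevian_trace B A C P
     \<and> Ordinary (T C) = cevian_trace C A B P)"

end

theory Submission imports Defs begin

text \<open>
  The theorem becomes an identity between weighted sums once points are given by homogeneous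
  barycentric coordinates, with infinite points being those of total weight zero.  If \<open>P\<close> has
  coordinates \<open>p : q : r\<close> with respect to \<open>ABC\<close>, the complement map, which sends each vertex to the
  midpoint of the opposite side, takes \<open>P\<close> to the point with coordinates \<open>q + r : p + r : p + q\<close>.
  Affine maps preserve barycentric coordinates, so the cevian map sends this point to the one with
  the same coordinates with respect to \<open>DEF\<close>.  Now the trace \<open>D\<close> of \<open>AP\<close> on \<open>BC\<close> satisfies
  \<open>(q + r) D = q B + r C\<close>, and cyclically, hence
  \[ (q + r) D + (p + r) E + (p + q) F = 2 (p A + q B + r C), \]
  and the total weights of the two sides agree as well.  The point obtained is therefore \<open>P\<close> itself,
  whether \<open>P\<close> is ordinary or infinite.

  The sums \<open>q + r\<close>, \<open>p + r\<close>, \<open>p + q\<close> vanish exactly on the sides of the anticomplementary triangle,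
  so the hypothesis on \<open>P\<close> makes the three traces ordinary points.  The rest is incidence geometry:
  two points lie on only one line, which gives the joins and meets in the definition of the traces
  their expected values, and an affine map is determined by its values at \<open>A\<close>, \<open>B\<close>, \<open>C\<close>.
\<close>

section \<open>Directions and incidence\<close>

definition direction_of :: "real^2 \<Rightarrow> direction" where
  "direction_of v = Abs_direction (span {v})"

lemma Rep_direction_of: "v \<noteq> 0 \<Longrightarrow> Rep_direction (direction_of v) = span {v}"
  unfolding direction_of_def by (rule Abs_direction_inverse) (simp add: dim_singleton)

lemma direction_of_scaleR:
  assumes "c \<noteq> 0"
  shows "direction_of (c *\<^sub>R v) = direction_of v"
proof -
  have "span {c *\<^sub>R v} = span {v}"
    using span_image_scale[of "{v}" "\<lambda>_. c"] assms by simp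
  then show ?thesis
    by (simp add: direction_of_def)
qed

lemma Rep_direction_eq_span:
  assumes "v \<in> Rep_direction d" "v \<noteq> 0"
  shows "Rep_direction d = span {v}"
proof -
  have d: "subspace (Rep_direction d)" "dim (Rep_direction d) = 1"
    using Rep_direction[of d] by auto
  have "span {v} \<subseteq> Rep_direction d"
    using assms(1) d(1) by (simp add: span_minimal)
  moreover have "dim (span {v}) = 1"
    using assms(2) by (simp add: dim_singleton)
  ultimately show ?thesis
    using subspace_dim_equal[of "span {v}" "Rep_direction d"] d by auto
qed

lemma direction_of_eqI:
  assumes "v \<in> Rep_direction d" "v \<noteq> 0"
  shows "d = direction_of v"
  using Rep_direction_eq_span[OF assms] Rep_direction_of[OF assms(2)]
  by (metis Rep_direction_inject)

lemma direction_obtain: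
  obtains v where "v \<noteq> 0" "d = direction_of v"
proof -
  have "dim (Rep_direction d) = 1"
    using Rep_direction[of d] by auto
  then have "\<not> Rep_direction d \<subseteq> {0}"
    by (metis dim_eq_0 zero_neq_one)
  then show ?thesis
    using direction_of_eqI that by blast
qed

lemma Ordinary_mem_affine_line:
  "Ordinary x \<in> affine_line a d \<longleftrightarrow> x - a \<in> Rep_direction d"
  unfolding affine_line_def by (auto simp: image_iff) (metis add_diff_cancel_left' diff_add_cancel add.commute)

lemma Infinite_mem_affine_line: "Infinite e \<in> affine_line a d \<longleftrightarrow> e = d"
  unfolding affine_line_def by auto

lemma affine_line_change_base:
  assumes "Ordinary x \<in> affine_line a d"
  shows "affine_line x d = affine_line a d"
proof -
  have s: "subspace (Rep_direction d)"
    using Rep_direction[of d] by auto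
  have xa: "x - a \<in> Rep_direction d"
    using assms by (simp add: Ordinary_mem_affine_line)
  have "y - x \<in> Rep_direction d \<longleftrightarrow> y - a \<in> Rep_direction d" for y
    using subspace_add[OF s _ xa, of "y - x"] subspace_diff[OF s _ xa, of "y - a"] by auto
  then have "Y \<in> affine_line x d \<longleftrightarrow> Y \<in> affine_line a d" for Y
    by (cases Y) (simp_all add: Ordinary_mem_affine_line Infinite_mem_affine_line)
  then show ?thesis by blast
qed

lemma line_through_ordinary:
  assumes "l \<in> lines" "Ordinary x \<in> l"
  obtains d where "l = affine_line x d"
  using assms affine_line_change_base unfolding lines_def line_at_infinity_def by fastforce

text \<open>All lines through an ordinary point \<open>x\<close> have base point \<open>x\<close>, so a second common point fixes
  the direction; only the line at infinity contains two infinite points.\<close>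

lemma line_unique:
  assumes "l \<in> lines" "m \<in> lines" "X \<in> l" "Y \<in> l" "X \<in> m" "Y \<in> m" "X \<noteq> Y"
  shows "l = m"
proof -
  have ord: "l = m"
    if h: "l \<in> lines" "m \<in> lines" "Ordinary x \<in> l" "Z \<in> l" "Ordinary x \<in> m" "Z \<in> m" "Ordinary x \<noteq> Z"
    for x Z
  proof -
    obtain d e where l: "l = affine_line x d" and m: "m = affine_line x e"
      using h line_through_ordinary by metis
    show ?thesis
    proof (cases Z)
      case (Ordinary z)
      have "z - x \<noteq> 0" "z - x \<in> Rep_direction d" "z - x \<in> Rep_direction e"
        using h Ordinary l m by (auto simp: Ordinary_mem_affine_line)
      then have "d = e"
        using direction_of_eqI by metis
      then show ?thesis using l m by simp
    next
      case (Infinite f)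
      then show ?thesis using h l m by (simp add: Infinite_mem_affine_line)
    qed
  qed
  show ?thesis
  proof (cases X)
    case (Ordinary x)
    then show ?thesis using ord assms by blast
  next
    case X: (Infinite d)
    show ?thesis
    proof (cases Y)
      case (Ordinary y)
      then show ?thesis using ord assms by blast
    next
      case (Infinite e)
      have "k = line_at_infinity" if "k \<in> lines" "X \<in> k" "Y \<in> k" for k
        using that assms(7) X Infinite
        unfolding lines_def by (auto simp: Infinite_mem_affine_line)
      then show ?thesis using assms by blast
    qed
  qed
qed

lemma join_eqI:
  assumes "l \<in> lines" "X \<in> l" "Y \<in> l" "X \<noteq> Y"
  shows "join X Y = l"
  unfolding join_def using assms line_unique by (intro the_equality) blast+

lemma meet_eqI:
  assumes "l \<in> lines" "m \<in> lines" "l \<noteq> m" "X \<in> l" "X \<in> m"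
  shows "meet l m = X"
  unfolding meet_def using assms line_unique by (intro the_equality) blast+

lemma affine_line_in_lines: "affine_line a d \<in> lines"
  unfolding lines_def by blast

lemma Ordinary_mem_affine_line_direction_of:
  assumes "v \<noteq> 0"
  shows "Ordinary x \<in> affine_line a (direction_of v) \<longleftrightarrow> (\<exists>t. x = a + t *\<^sub>R v)"
proof -
  have "Ordinary x \<in> affine_line a (direction_of v) \<longleftrightarrow> (\<exists>t. x - a = t *\<^sub>R v)"
    by (auto simp: Ordinary_mem_affine_line Rep_direction_of[OF assms] span_singleton)
  then show ?thesis by (simp add: algebra_simps)
qed

lemma join_ordinary:
  assumes "a \<noteq> b"
  shows "join (Ordinary a) (Ordinary b) = affine_line a (direction_of (b - a))"
proof (rule join_eqI)
  show "Ordinary a \<in> affine_line a (direction_of (b - a))"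
    using assms by (simp add: Ordinary_mem_affine_line_direction_of exI[of _ 0])
  show "Ordinary b \<in> affine_line a (direction_of (b - a))"
    using assms by (simp add: Ordinary_mem_affine_line_direction_of exI[of _ 1])
qed (use assms affine_line_in_lines in auto)

section \<open>Barycentric coordinates\<close>

text \<open>The point with homogeneous coordinates \<open>p : q : r\<close>.  With total weight zero, the weighted sum
  is a vector independent of the origin, and the point is its direction.  This needs the vector to
  be nonzero.\<close>

definition barycentric ::
  "real^2 \<Rightarrow> real^2 \<Rightarrow> real^2 \<Rightarrow> real \<Rightarrow> real \<Rightarrow> real \<Rightarrow> point" where
  "barycentric A B C p q r =
    (if p + q + r = 0 then Infinite (direction_of (p *\<^sub>R A + q *\<^sub>R B + r *\<^sub>R C))
     else Ordinary ((1 / (p + q + r)) *\<^sub>R (p *\<^sub>R A + q *\<^sub>R B + r *\<^sub>R C)))"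

lemma barycentric_swap: "barycentric A B C p q r = barycentric B A C q p r"
  by (simp add: barycentric_def add_ac)

lemma barycentric_rotate: "barycentric A B C p q r = barycentric C A B r p q"
  by (simp add: barycentric_def add_ac)

lemma barycentric_proportional:
  assumes "c \<noteq> 0" "p' + q' + r' = c * (p + q + r)"
    and "p' *\<^sub>R A' + q' *\<^sub>R B' + r' *\<^sub>R C' = c *\<^sub>R (p *\<^sub>R A + q *\<^sub>R B + r *\<^sub>R C)"
  shows "barycentric A' B' C' p' q' r' = barycentric A B C p q r"
  using assms(1) by (simp add: barycentric_def assms(2,3) direction_of_scaleR)

lemma noncollinear_span:
  assumes "\<not> collinear {A, B, C :: real^2}"
  shows "independent {B - A, C - A}" "B - A \<noteq> C - A" "span {B - A, C - A} = UNIV"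
proof -
  have ne: "A \<noteq> B" "A \<noteq> C" "B \<noteq> C" and aff: "\<not> affine_dependent {A, B, C}"
    using assms by (auto simp: collinear_3_eq_affine_dependent)
  show "B - A \<noteq> C - A"
    using ne by simp
  have img: "(\<lambda>x. - A + x) ` {B, C} = {B - A, C - A}"
    by auto
  show ind: "independent {B - A, C - A}"
    using aff affine_dependent_iff_dependent2[of A "{A, B, C}"] ne
    by (auto simp: insert_Diff_if img)
  have "card {B - A, C - A} = 2"
    using ne by simp
  then show "span {B - A, C - A} = UNIV"
    using card_ge_dim_independent[OF subset_UNIV ind] by auto
qed

lemma barycentric_vector:
  assumes "\<not> collinear {A, B, C :: real^2}"
  obtains p q r where "p + q + r = s" "v = p *\<^sub>R A + q *\<^sub>R B + r *\<^sub>R C"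
proof -
  have "v - s *\<^sub>R A \<in> span {B - A, C - A}"
    using noncollinear_span(3)[OF assms] by simp
  then obtain q r where "v - s *\<^sub>R A = q *\<^sub>R (B - A) + r *\<^sub>R (C - A)"
    unfolding span_breakdown_eq span_singleton by (auto simp: algebra_simps)
  then have "v = (s - q - r) *\<^sub>R A + q *\<^sub>R B + r *\<^sub>R C"
    by (simp add: algebra_simps)
  then show ?thesis
    using that[of "s - q - r" q r] by simp
qed

lemma barycentric_obtain:
  assumes "\<not> collinear {A, B, C}"
  obtains p q r where "P = barycentric A B C p q r"
    "p + q + r = 0 \<Longrightarrow> p *\<^sub>R A + q *\<^sub>R B + r *\<^sub>R C \<noteq> 0"
proof (cases P)
  case (Ordinary x)
  obtain p q r where "p + q + r = 1" "x = p *\<^sub>R A + q *\<^sub>R B + r *\<^sub>R C"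
    using barycentric_vector[OF assms] by metis
  then show ?thesis
    using that[of p q r] Ordinary by (simp add: barycentric_def)
next
  case (Infinite d)
  obtain v where v: "v \<noteq> 0" "d = direction_of v"
    by (rule direction_obtain)
  obtain p q r where "p + q + r = 0" "v = p *\<^sub>R A + q *\<^sub>R B + r *\<^sub>R C"
    using barycentric_vector[OF assms] by metis
  then show ?thesis
    using that[of p q r] Infinite v by (simp add: barycentric_def)
qed

section \<open>Affine maps\<close>

lemma extend_barycentric:
  assumes "affine_map f" and nz: "p + q + r = 0 \<Longrightarrow> p *\<^sub>R A + q *\<^sub>R B + r *\<^sub>R C \<noteq> 0"
  shows "extend f (barycentric A B C p q r) = barycentric (f A) (f B) (f C) p q r"
proof -
  obtain g b where g: "linear g" and f: "\<And>x. f x = g x + b"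
    using assms(1) unfolding affine_map_def by blast
  let ?v = "p *\<^sub>R A + q *\<^sub>R B + r *\<^sub>R C"
  have sum: "p *\<^sub>R f A + q *\<^sub>R f B + r *\<^sub>R f C = g ?v + (p + q + r) *\<^sub>R b"
    by (simp add: f linear_add[OF g] linear_scale[OF g] algebra_simps)
  show ?thesis
  proof (cases "p + q + r = 0")
    case True
    have "(\<lambda>v. f v - f 0) ` span {?v} = span {g ?v}"
      using linear_span_image[OF g, of "{?v}"] by (simp add: f linear_0[OF g])
    then have "extend f (Infinite (direction_of ?v)) = Infinite (direction_of (g ?v))"
      by (simp only: extend.simps Rep_direction_of[OF nz[OF True]]) (simp only: direction_of_def)
    then show ?thesis
      using True sum by (simp add: barycentric_def)
  next
    case False
    then have "f ((1 / (p + q + r)) *\<^sub>R ?v) = (1 / (p + q + r)) *\<^sub>R (g ?v + (p + q + r) *\<^sub>R b)"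
      by (simp only: f linear_scale[OF g]) (simp add: scaleR_right_distrib[of _ "g ?v"])
    then show ?thesis
      using False unfolding barycentric_def sum by simp
  qed
qed

text \<open>Applied to ordinary points, preservation of barycentric coordinates shows that the values at
  the vertices of a triangle determine an affine map.\<close>

lemma affine_map_unique:
  assumes "\<not> collinear {A, B, C}" "affine_map f" "affine_map g"
    and "f A = g A" "f B = g B" "f C = g C"
  shows "f = g"
proof
  fix x
  obtain p q r where "Ordinary x = barycentric A B C p q r"
    and "p + q + r = 0 \<Longrightarrow> p *\<^sub>R A + q *\<^sub>R B + r *\<^sub>R C \<noteq> 0"
    using barycentric_obtain[OF assms(1), of "Ordinary x"] by metis
  then have "extend f (Ordinary x) = extend g (Ordinary x)"
    using extend_barycentric assms by simp
  then show "f x = g x" by simp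
qed

lemma affine_map_exists:
  assumes "\<not> collinear {A, B, C}"
  obtains f where "affine_map f" "f A = D" "f B = E" "f C = F"
proof -
  note ind = noncollinear_span[OF assms]
  obtain g where g: "linear g"
    and ext: "\<forall>x\<in>{B - A, C - A}. g x = (if x = B - A then E - D else F - D)"
    using linear_independent_extend[OF ind(1), of "\<lambda>x. if x = B - A then E - D else F - D"] by auto
  have "g (B - A) = E - D" "g (C - A) = F - D"
    using ext ind(2) by simp_all
  then have gB: "g B - g A = E - D" and gC: "g C - g A = F - D"
    by (simp_all add: linear_diff[OF g])
  define f where "f x = g x + (D - g A)" for x
  show ?thesis
  proof (rule that)
    show "affine_map f" unfolding affine_map_def f_def using g by blast
    show "f A = D" "f B = E" "f C = F"
      using gB gC by (simp_all add: f_def algebra_simps)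
  qed
qed

lemma complement_affine_map: "affine_map (complement A B C)"
  unfolding affine_map_def complement_def
  by (rule exI[of _ "\<lambda>x. (- 1/2) *\<^sub>R x"], rule exI[of _ "(3/2) *\<^sub>R centroid A B C"])
     (auto simp: linear_iff vec_eq_iff field_simps)

lemma complement_vertices:
  "complement A B C A = (1/2) *\<^sub>R (B + C)"
  "complement A B C B = (1/2) *\<^sub>R (A + C)"
  "complement A B C C = (1/2) *\<^sub>R (A + B)"
  by (simp_all add: complement_def centroid_def vec_eq_iff field_simps)

lemma inv_complement: "inv (complement A B C) X = A + B + C - 2 *\<^sub>R X"
proof (rule inv_f_eq)
  show "inj (complement A B C)"
    by (rule injI) (simp add: complement_def)
  show "complement A B C (A + B + C - 2 *\<^sub>R X) = X"
    by (simp add: complement_def centroid_def vec_eq_iff field_simps)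
qed

lemma extend_complement_barycentric:
  assumes "p + q + r = 0 \<Longrightarrow> p *\<^sub>R A + q *\<^sub>R B + r *\<^sub>R C \<noteq> 0"
  shows "extend (complement A B C) (barycentric A B C p q r)
    = barycentric A B C (q + r) (p + r) (p + q)"
proof -
  have "extend (complement A B C) (barycentric A B C p q r)
      = barycentric ((1/2) *\<^sub>R (B + C)) ((1/2) *\<^sub>R (A + C)) ((1/2) *\<^sub>R (A + B)) p q r"
    using extend_barycentric[OF complement_affine_map assms] by (simp add: complement_vertices)
  also have "\<dots> = barycentric A B C (q + r) (p + r) (p + q)"
    by (rule barycentric_proportional[where c = "1/2"]) (simp_all add: vec_eq_iff field_simps)
  finally show ?thesis .
qed

section \<open>The cevian triangle\<close>

text \<open>The line through \<open>A\<close> parallel to \<open>BC\<close> has the equation \<open>q + r = 0\<close>; it joins the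
  anticomplementary vertices \<open>A + C - B\<close> and \<open>A + B - C\<close>.\<close>

lemma weight_sum_nonzero:
  assumes "B \<noteq> C" and off: "barycentric A B C p q r \<notin> join (Ordinary (A + C - B)) (Ordinary (A + B - C))"
    and nz: "p + q + r = 0 \<Longrightarrow> p *\<^sub>R A + q *\<^sub>R B + r *\<^sub>R C \<noteq> 0"
  shows "q + r \<noteq> 0"
proof
  assume "q + r = 0"
  then have r: "r = - q" by simp
  have dir: "direction_of (A + B - C - (A + C - B)) = direction_of (B - C)"
    using direction_of_scaleR[of 2 "B - C"] by (simp add: scaleR_2 algebra_simps)
  have "A + B - C - (A + C - B) = 2 *\<^sub>R (B - C)"
    by (simp add: scaleR_2)
  then have vertices_ne: "A + C - B \<noteq> A + B - C"
    using assms(1) by auto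
  have join: "join (Ordinary (A + C - B)) (Ordinary (A + B - C))
      = affine_line (A + C - B) (direction_of (B - C))"
    by (rule join_ordinary[OF vertices_ne, unfolded dir])
  show False
  proof (cases "p = 0")
    case True
    then have "q *\<^sub>R (B - C) \<noteq> 0"
      using nz r by (simp add: algebra_simps)
    then have "direction_of (q *\<^sub>R (B - C)) = direction_of (B - C)"
      by (simp add: direction_of_scaleR)
    then show False
      using off True r by (simp add: barycentric_def join Infinite_mem_affine_line algebra_simps)
  next
    case False
    then have "barycentric A B C p q r = Ordinary ((A + C - B) + (1 + q / p) *\<^sub>R (B - C))"
      using r by (simp add: barycentric_def vec_eq_iff field_simps)
    then show False
      using off assms(1) by (auto simp: join Ordinary_mem_affine_line_direction_of)
  qed
qed

text \<open>The point \<open>D\<close> with \<open>(q + r) D = q B + r C\<close> lies on \<open>BC\<close>, and \<open>P\<close> lies on the line \<open>AD\<close>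
  because its weighted sum is \<open>p A + (q + r) D\<close>.\<close>

lemma cevian_trace_barycentric:
  assumes nc: "\<not> collinear {A, B, C}" and qr: "q + r \<noteq> 0"
  shows "cevian_trace A B C (barycentric A B C p q r)
    = Ordinary ((1 / (q + r)) *\<^sub>R (q *\<^sub>R B + r *\<^sub>R C))"
proof -
  define D where "D = (1 / (q + r)) *\<^sub>R (q *\<^sub>R B + r *\<^sub>R C)"
  define P where "P = barycentric A B C p q r"
  let ?AD = "affine_line A (direction_of (D - A))"
  have BC: "B \<noteq> C"
    using nc by auto
  have D_BC: "D = B + (r / (q + r)) *\<^sub>R (C - B)"
    using qr by (simp add: D_def vec_eq_iff field_simps)
  have A_off: "A \<noteq> B + t *\<^sub>R (C - B)" for t
  proof
    assume "A = B + t *\<^sub>R (C - B)"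
    then have "collinear {B, A, C}"
      by (auto simp: collinear_3_expand algebra_simps intro!: exI[of _ "1 - t"])
    then show False
      using nc by (simp add: insert_commute)
  qed
  then have DA: "D - A \<noteq> 0"
    using D_BC by (metis eq_iff_diff_eq_0)
  have sum: "p *\<^sub>R A + q *\<^sub>R B + r *\<^sub>R C = (p + q + r) *\<^sub>R A + (q + r) *\<^sub>R (D - A)"
    using qr by (simp add: D_def scaleR_diff_right) (simp add: algebra_simps)
  have "P \<in> ?AD \<and> P \<noteq> Ordinary A"
  proof (cases "p + q + r = 0")
    case True
    then show ?thesis
      using qr by (simp add: P_def barycentric_def sum direction_of_scaleR Infinite_mem_affine_line)
  next
    case False
    then have "P = Ordinary (A + ((q + r) / (p + q + r)) *\<^sub>R (D - A))"
      by (simp add: P_def barycentric_def sum scaleR_add_right)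
    then show ?thesis
      using False qr DA by (auto simp: Ordinary_mem_affine_line_direction_of)
  qed
  moreover have A_AD: "Ordinary A \<in> ?AD"
    using DA by (simp add: Ordinary_mem_affine_line_direction_of exI[of _ 0])
  ultimately have AP: "join (Ordinary A) P = ?AD"
    using join_eqI affine_line_in_lines by metis
  have BC_line: "join (Ordinary B) (Ordinary C) = affine_line B (direction_of (C - B))"
    using join_ordinary[OF BC] .
  have "meet ?AD (affine_line B (direction_of (C - B))) = Ordinary D"
  proof (rule meet_eqI)
    have "Ordinary A \<notin> affine_line B (direction_of (C - B))"
      using BC A_off by (auto simp: Ordinary_mem_affine_line_direction_of)
    then show "?AD \<noteq> affine_line B (direction_of (C - B))"
      using A_AD by metis
    show "Ordinary D \<in> ?AD"
      using DA by (auto simp: Ordinary_mem_affine_line_direction_of intro: exI[of _ 1])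
    show "Ordinary D \<in> affine_line B (direction_of (C - B))"
      using BC D_BC by (auto simp: Ordinary_mem_affine_line_direction_of)
  qed (rule affine_line_in_lines)+
  then show ?thesis
    by (simp add: cevian_trace_def AP BC_line flip: P_def D_def)
qed

lemma cevian_map_eqI:
  assumes "\<not> collinear {A, B, C}" "affine_map T"
    and "cevian_trace A B C P = Ordinary (T A)"
    and "cevian_trace B A C P = Ordinary (T B)"
    and "cevian_trace C A B P = Ordinary (T C)"
  shows "cevian_map A B C P = T"
  unfolding cevian_map_def assms(3-5)
  by (rule the_equality) (use assms(1,2) affine_map_unique in auto)

theorem theorem3p6:
  fixes A B C :: "real^2" and P Q' :: point
  assumes "\<not> collinear {A, B, C}"
    and "\<forall>l \<in> sides A B C. P \<notin> l"
    and "\<forall>l \<in> anticomplementary_sides A B C. P \<notin> l"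
    and "Q' = extend (complement A B C) P"
  shows "extend (cevian_map A B C P) (extend (complement A B C) P)
           = extend (cevian_map A B C P) Q'
       \<and> extend (cevian_map A B C P) Q' = P"
proof -
  note nc = assms(1)
  obtain p q r where P: "P = barycentric A B C p q r"
    and nz: "p + q + r = 0 \<Longrightarrow> p *\<^sub>R A + q *\<^sub>R B + r *\<^sub>R C \<noteq> 0"
    using barycentric_obtain[OF nc, of P] by metis
  note P_swap = P[unfolded barycentric_swap[of A B C]]
    and P_rotate = P[unfolded barycentric_rotate[of A B C]]
  have ne: "B \<noteq> C" "A \<noteq> C" "A \<noteq> B"
    using nc by (auto simp: insert_commute)
  have nc': "\<not> collinear {B, A, C}" "\<not> collinear {C, A, B}"
    using nc by (simp_all add: insert_commute)
  have inv: "inv (complement A B C) A = B + C - A" "inv (complement A B C) B = A + C - B"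
    "inv (complement A B C) C = A + B - C"
    by (simp_all add: inv_complement scaleR_2)
  have off: "P \<notin> join (Ordinary (A + C - B)) (Ordinary (A + B - C))"
    "P \<notin> join (Ordinary (B + C - A)) (Ordinary (A + B - C))"
    "P \<notin> join (Ordinary (B + C - A)) (Ordinary (A + C - B))"
    using assms(3) by (simp_all add: anticomplementary_sides_def sides_def inv)
  have qr: "q + r \<noteq> 0"
    by (rule weight_sum_nonzero[OF ne(1)]) (use off(1) P nz in auto)
  have pr: "p + r \<noteq> 0"
    by (rule weight_sum_nonzero[OF ne(2), of B q])
       (use off(2) P_swap nz in \<open>auto simp: add_ac\<close>)
  have pq: "p + q \<noteq> 0"
    by (rule weight_sum_nonzero[OF ne(3), of C r])
       (use off(3) P_rotate nz in \<open>auto simp: add_ac\<close>)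
  obtain T where T: "affine_map T"
    and D: "T A = (1 / (q + r)) *\<^sub>R (q *\<^sub>R B + r *\<^sub>R C)"
    and E: "T B = (1 / (p + r)) *\<^sub>R (p *\<^sub>R A + r *\<^sub>R C)"
    and F: "T C = (1 / (p + q)) *\<^sub>R (p *\<^sub>R A + q *\<^sub>R B)"
    using affine_map_exists[OF nc] by metis
  have map: "cevian_map A B C P = T"
  proof (rule cevian_map_eqI[OF nc T])
    show "cevian_trace A B C P = Ordinary (T A)"
      unfolding P D by (rule cevian_trace_barycentric[OF nc qr])
    show "cevian_trace B A C P = Ordinary (T B)"
      unfolding P_swap E by (rule cevian_trace_barycentric[OF nc'(1) pr])
    show "cevian_trace C A B P = Ordinary (T C)"
      unfolding P_rotate F by (rule cevian_trace_barycentric[OF nc'(2) pq])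
  qed
  have Q: "Q' = barycentric A B C (q + r) (p + r) (p + q)"
    unfolding assms(4) P by (rule extend_complement_barycentric[OF nz])
  have nz': "(q + r) *\<^sub>R A + (p + r) *\<^sub>R B + (p + q) *\<^sub>R C \<noteq> 0"
    if "(q + r) + (p + r) + (p + q) = 0"
  proof -
    \<comment> \<open>For total weight zero the complementary weights are \<open>- p\<close>, \<open>- q\<close>, \<open>- r\<close>.\<close>
    have s: "q + r = - p" "p + r = - q" "p + q = - r"
      using that by linarith+
    have "p *\<^sub>R A + q *\<^sub>R B + r *\<^sub>R C \<noteq> 0"
      using nz that by simp
    then show ?thesis
      unfolding s by (metis (no_types) add.inverse_neutral minus_add_distrib neg_equal_iff_equal scaleR_minus_left)
  qed
  have "extend T Q' = barycentric (T A) (T B) (T C) (q + r) (p + r) (p + q)"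
    unfolding Q by (rule extend_barycentric[OF T nz'])
  also have "\<dots> = P"
    unfolding P
  proof (rule barycentric_proportional[where c = 2])
    show "(q + r) *\<^sub>R T A + (p + r) *\<^sub>R T B + (p + q) *\<^sub>R T C
        = 2 *\<^sub>R (p *\<^sub>R A + q *\<^sub>R B + r *\<^sub>R C)"
      using qr pr pq by (simp add: D E F scaleR_2)
  qed simp_all
  finally show ?thesis
    using map assms(4) by simp
qed

end
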